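(* For every $n\in\mathbb{Z}$, the binary operation $\oplus_n$ on the extended reals $\mathbb{R}_\infty=\mathbb{R}\cup\{-\infty,+\infty\}$ satisfies the following, for all $x,y,z\in\mathbb{R}_\infty$ for which every operation occurring in the respective identity is defined: (i) $\oplus_n$ is associative: $(x\oplus_n y)\oplus_n z = x\oplus_n(y\oplus_n z)$. (ii) $\oplus_n$ is commutative: $x\oplus_n y=y\oplus_n x$. (iii) $\oplus_n$ distributes over $\oplus_{n-1}$: $x\oplus_n (y\oplus_{n-1} z)=(x\oplus_n y)\oplus_{n-1}(x\oplus_n z)$.
   Context: $\mathbb{R}_\infty=\mathbb{R}\cup\{-\infty,+\infty\}$ is the extended real number system with the usual operational conventions; expressions such as $\infty-\infty$ are undefined. Conventions: $\ln(0):=-\infty$, $\ln(+\infty)=+\infty$, $e^{-\infty}:=0$, $e^{+\infty}:=+\infty$. The (possibly partial) operations $\oplus_n$, $n\in\mathbb{Z}$, are defined recursively: - $x\oplus_0 y:=x+y$; - for $n\le 0$: $x\oplus_{n-1}y:=\ln(e^x\oplus_n e^y)$; - for $n\ge 0$: $x\oplus_{n+1}y:=\exp[\ln(x)\oplus_n\ln(y)]$, defined provided $x\ge 0$ and $y\ge 0$ and $\ln(x)\oplus_n\ln(y)$ is itself defined. Thus $\oplus_1$ is ordinary multiplication of nonnegative numbers, and $x\oplus_{-1}y=\ln(e^x+e^y)$. *)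

theory Defs
  imports "HOL-Library.Extended_Real" "HOL-Library.Monad_Syntax"
begin

text \<open>
  Partial operations on the extended reals are \<^typ>\<open>ereal option\<close>-valued; \<^const>\<open>None\<close> means
  ``undefined''. The library's \<open>+\<close> on \<^typ>\<open>ereal\<close> is total, with \<open>\<infinity> + (-\<infinity>) = \<infinity>\<close>;
  that case is undefined here.
\<close>

definition eadd :: "ereal \<Rightarrow> ereal \<Rightarrow> ereal option" where
  "eadd x y =
    (if x = \<infinity> \<and> y = -\<infinity> \<or> x = -\<infinity> \<and> y = \<infinity> then None else Some (x + y))"

function eexp :: "ereal \<Rightarrow> ereal" where
  "eexp (ereal r) = ereal (exp r)"
| "eexp \<infinity> = \<infinity>"
| "eexp (-\<infinity>) = 0"
proof -
  fix P :: bool and x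
  assume "\<And>r. x = ereal r \<Longrightarrow> P" "x = \<infinity> \<Longrightarrow> P" "x = -\<infinity> \<Longrightarrow> P"
  then show P by (cases x) auto
qed simp_all
termination by lexicographic_order

function eln :: "ereal \<Rightarrow> ereal option" where
  "eln (ereal r) =
    (if r < 0 then None else if r = 0 then Some (-\<infinity>) else Some (ereal (ln r)))"
| "eln \<infinity> = Some \<infinity>"
| "eln (-\<infinity>) = None"
proof -
  fix P :: bool and x
  assume "\<And>r. x = ereal r \<Longrightarrow> P" "x = \<infinity> \<Longrightarrow> P" "x = -\<infinity> \<Longrightarrow> P"
  then show P by (cases x) auto
qed simp_all
termination by lexicographic_order

text \<open>
  \<open>hyperop n x y\<close> is $x \oplus_n y$. The recursion runs towards \<open>n = 0\<close>; the defining equations in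
  the form indexed by \<open>n - 1\<close> (for \<open>n \<le> 0\<close>) and \<open>n + 1\<close> (for \<open>n \<ge> 0\<close>) are derived below.
\<close>

function hyperop :: "int \<Rightarrow> ereal \<Rightarrow> ereal \<Rightarrow> ereal option" where
  "hyperop n x y =
    (if n = 0 then eadd x y
     else if n < 0 then
       do { w \<leftarrow> hyperop (n + 1) (eexp x) (eexp y); eln w }
     else if 0 \<le> x \<and> 0 \<le> y then
       do { u \<leftarrow> eln x; v \<leftarrow> eln y; w \<leftarrow> hyperop (n - 1) u v; Some (eexp w) }
     else None)"
  by pat_completeness auto
termination
  by (relation "Wellfounded.measure (\<lambda>(n, x, y). nat \<bar>n\<bar>)") auto

declare hyperop.simps [simp del]

lemma eln_eq_None_iff: "eln x = None \<longleftrightarrow> x < 0"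
  by (cases x) auto

lemma hyperop_zero: "hyperop 0 x y = eadd x y"
  by (simp add: hyperop.simps)

lemma hyperop_minus_one:
  assumes "n \<le> 0"
  shows "hyperop (n - 1) x y = do { w \<leftarrow> hyperop n (eexp x) (eexp y); eln w }"
  using assms by (subst hyperop.simps) simp

lemma hyperop_plus_one:
  assumes "n \<ge> 0"
  shows "hyperop (n + 1) x y =
    (if 0 \<le> x \<and> 0 \<le> y
     then do { u \<leftarrow> eln x; v \<leftarrow> eln y; w \<leftarrow> hyperop n u v; Some (eexp w) }
     else None)"
  using assms by (subst hyperop.simps) simp

end

theory Submission
  imports Defs
begin

text \<open>
  For every integer \<open>n\<close>, including \<open>n > 0\<close>, the graph of \<open>\<oplus>\<^sub>n\<^sub>-\<^sub>1\<close> is the preimage of the graph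
  of \<open>\<oplus>\<^sub>n\<close> under \<open>exp\<close>, and for \<open>n \<ge> 0\<close> nothing is lost on nonnegative arguments because \<open>exp\<close>
  is a bijection onto \<open>[0, \<infinity>]\<close> and \<open>\<oplus>\<^sub>n\<close> preserves nonnegativity there. So each identity
  propagates in both directions from \<open>n = 0\<close>, where the first two are laws of addition and the
  third, after exponentiation, is \<open>a(b + c) = ab + ac\<close>.
\<close>

lemma eexp_inject [simp]: "eexp x = eexp y \<longleftrightarrow> x = y"
  by (cases x; cases y) (auto simp: zero_ereal_def)

lemma eexp_nonneg [simp]: "0 \<le> eexp x"
  by (cases x) auto

lemma eln_eq_Some_iff: "eln w = Some a \<longleftrightarrow> w = eexp a"
  by (cases w; cases a) (auto simp: zero_ereal_def)

lemma eln_eexp [simp]: "eln (eexp x) = Some x"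
  by (simp add: eln_eq_Some_iff)

lemma nonneg_imp_eexp:
  assumes "0 \<le> x"
  obtains u where "x = eexp u"
  using assms by (cases "eln x") (auto simp: eln_eq_None_iff eln_eq_Some_iff)

text \<open>Definedness matters: the total \<open>+\<close> gives
  \<open>\<infinity> + (-\<infinity>) = \<infinity>\<close>, whereas the corresponding product
  \<open>\<infinity> * 0\<close> is \<open>0\<close>.\<close>

lemma eadd_eexp:
  assumes "eadd x y = Some a"
  shows "eexp a = eexp x * eexp y"
  using assms by (cases x; cases y) (auto simp: eadd_def exp_add split: if_splits)

text \<open>For \<open>n \<le> 0\<close> this unfolds the left operation, since \<open>eln\<close>
  inverts \<open>eexp\<close>; for \<open>n > 0\<close> it unfolds the right one at nonnegative
  arguments.\<close>

lemma hyperop_pred_eq_Some_iff: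
  "hyperop (n - 1) x y = Some a \<longleftrightarrow> hyperop n (eexp x) (eexp y) = Some (eexp a)"
proof (cases "n \<le> 0")
  case True
  then show ?thesis
    by (auto simp: hyperop_minus_one eln_eq_Some_iff bind_eq_Some_conv)
next
  case False
  then show ?thesis
    using hyperop_plus_one[of "n - 1" "eexp x" "eexp y"] by (auto simp: bind_eq_Some_conv)
qed

lemma hyperop_succ_eq_SomeE:
  assumes "hyperop (n + 1) x y = Some a" and "n \<ge> 0"
  obtains u v c where "x = eexp u" "y = eexp v" "a = eexp c" "hyperop n u v = Some c"
  using assms
  by (auto simp: hyperop_plus_one bind_eq_Some_conv eln_eq_Some_iff split: if_splits)

text \<open>A sum of nonnegative terms for \<open>n = 0\<close>, and an exponential for
  \<open>n > 0\<close>.\<close>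

lemma hyperop_nonneg:
  assumes "hyperop n x y = Some a" and "n \<ge> 0" "0 \<le> x" "0 \<le> y"
  shows "0 \<le> a"
proof (cases "n = 0")
  case True
  then show ?thesis
    using assms by (auto simp: hyperop_zero eadd_def split: if_splits)
next
  case False
  then have "hyperop (n - 1 + 1) x y = Some a" "n - 1 \<ge> 0"
    using assms by simp_all
  then obtain c where "a = eexp c"
    by (rule hyperop_succ_eq_SomeE)
  then show ?thesis by simp
qed

lemma hyperop_commute: "hyperop n x y = hyperop n y x"
proof (induction n arbitrary: x y rule: int_induct[where k = 0])
  case base
  then show ?case by (auto simp: hyperop_zero eadd_def add.commute)
next
  case (step1 i)
  then show ?case
    by (cases "eln x"; cases "eln y") (auto simp: hyperop_plus_one)
next
  case (step2 i)
  then show ?case by (simp add: hyperop_minus_one)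
qed

lemma hyperop_assoc:
  assumes "hyperop n x y = Some xy" "hyperop n xy z = Some l"
    and "hyperop n y z = Some yz" "hyperop n x yz = Some r"
  shows "l = r"
  using assms
proof (induction n arbitrary: x y z xy yz l r rule: int_induct[where k = 0])
  case base
  then have "xy = x + y" "l = xy + z" "yz = y + z" "r = x + yz"
    by (simp_all add: hyperop_zero eadd_def split: if_splits)
  then show ?case by (simp add: add.assoc)
next
  case (step1 i)
  \<comment> \<open>Each premise yields its own logarithms; injectivity of \<open>eexp\<close>
    identifies those of the same element, so the induction hypothesis applies.\<close>
  from step1.prems \<open>i \<ge> 0\<close> show ?case
    by (auto elim!: hyperop_succ_eq_SomeE dest: step1.IH)
next
  case (step2 i)
  have "eexp l = eexp r"
    using step2.prems unfolding hyperop_pred_eq_Some_iff by (rule step2.IH)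
  then show ?case by simp
qed

lemma hyperop_distrib:
  assumes "hyperop (n - 1) y z = Some yz" "hyperop n x yz = Some l"
    and "hyperop n x y = Some xy" "hyperop n x z = Some xz" "hyperop (n - 1) xy xz = Some r"
  shows "l = r"
  using assms
proof (induction n arbitrary: x y z yz xy xz l r rule: int_induct[where k = 0])
  case base
  have add: "eexp yz = eexp y + eexp z" "eexp r = eexp xy + eexp xz"
    using base.prems(1,5) unfolding hyperop_pred_eq_Some_iff hyperop_zero
    by (simp_all add: eadd_def split: if_splits)
  have mult: "eexp l = eexp x * eexp yz" "eexp xy = eexp x * eexp y" "eexp xz = eexp x * eexp z"
    using base.prems(2,3,4) by (simp_all add: hyperop_zero eadd_eexp)
  \<comment> \<open>Distributivity in \<open>ereal\<close> is safe here because the summands, being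
    exponentials, are nonnegative.\<close>
  have "eexp l = eexp r"
    unfolding mult add by (simp add: ereal_right_distrib)
  then show ?case by simp
next
  case (step1 i)
  obtain u v where uv: "x = eexp u" "y = eexp v"
    using step1.prems(3) \<open>i \<ge> 0\<close> by (rule hyperop_succ_eq_SomeE)
  obtain w where w: "z = eexp w"
    using step1.prems(4) \<open>i \<ge> 0\<close> by (rule hyperop_succ_eq_SomeE)
  obtain a where a: "xy = eexp a"
    using step1.prems(3) \<open>i \<ge> 0\<close> by (rule hyperop_succ_eq_SomeE)
  obtain b where b: "xz = eexp b"
    using step1.prems(4) \<open>i \<ge> 0\<close> by (rule hyperop_succ_eq_SomeE)
  obtain c d where cd: "yz = eexp c" "l = eexp d"
    using step1.prems(2) \<open>i \<ge> 0\<close> by (rule hyperop_succ_eq_SomeE)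
  \<comment> \<open>For \<open>i = 0\<close> the value \<open>r\<close> is a plain sum, so it is an
    exponential only because \<open>xy\<close> and \<open>xz\<close> are nonnegative.\<close>
  have "0 \<le> r"
    using step1.prems(5) \<open>i \<ge> 0\<close> hyperop_nonneg[of i xy xz r] by (simp add: a b)
  then obtain e where e: "r = eexp e"
    by (rule nonneg_imp_eexp)
  have "d = e"
  proof (rule step1.IH)
    show "hyperop (i - 1) v w = Some c" "hyperop (i - 1) a b = Some e"
      using step1.prems(1,5) by (simp_all add: hyperop_pred_eq_Some_iff uv w a b cd e)
    show "hyperop i u c = Some d" "hyperop i u v = Some a" "hyperop i u w = Some b"
      using step1.prems(2,3,4) hyperop_pred_eq_Some_iff[of "i + 1"]
      by (simp_all add: uv w a b cd e)
  qed
  then show ?case by (simp add: cd e)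
next
  case (step2 i)
  have "eexp l = eexp r"
    using step2.prems
    unfolding hyperop_pred_eq_Some_iff
    \<comment> \<open>Unfolding lifts the premises at level \<open>i - 2\<close> twice, up to level
      \<open>i\<close>. The explicit instances keep the induction hypothesis at single exponentials;
      its level \<open>i - 1\<close> goals are then lifted once to match.\<close>
    by (intro step2.IH[where y = "eexp y" and z = "eexp z" and yz = "eexp yz" and x = "eexp x"
          and xy = "eexp xy" and xz = "eexp xz"]) (simp_all only: hyperop_pred_eq_Some_iff)
  then show ?case by simp
qed

theorem theorem2p1:
  fixes n :: int
  shows
    "(\<forall>x y z xy yz l r.
        hyperop n x y = Some xy \<and> hyperop n xy z = Some l \<and>
        hyperop n y z = Some yz \<and> hyperop n x yz = Some r
        \<longrightarrow> l = r) \<and>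
     (\<forall>x y l r.
        hyperop n x y = Some l \<and> hyperop n y x = Some r
        \<longrightarrow> l = r) \<and>
     (\<forall>x y z yz xy xz l r.
        hyperop (n - 1) y z = Some yz \<and> hyperop n x yz = Some l \<and>
        hyperop n x y = Some xy \<and> hyperop n x z = Some xz \<and> hyperop (n - 1) xy xz = Some r
        \<longrightarrow> l = r)"
proof (intro conjI allI impI; elim conjE)
  show "l = r"
    if "hyperop n x y = Some xy" "hyperop n xy z = Some l"
      "hyperop n y z = Some yz" "hyperop n x yz = Some r" for x y z xy yz l r
    using that by (rule hyperop_assoc)
  show "l = r" if "hyperop n x y = Some l" "hyperop n y x = Some r" for x y l r
    using that hyperop_commute[of n x y] by simp
  show "l = r"
    if "hyperop (n - 1) y z = Some yz" "hyperop n x yz = Some l"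
      "hyperop n x y = Some xy" "hyperop n x z = Some xz" "hyperop (n - 1) xy xz = Some r"
    for x y z yz xy xz l r
    using that by (rule hyperop_distrib)
qed

end
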